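(* Let $0<\theta<1$. On the parameter range $\mu>-1$, $q\ge0$, $0<\gamma<\theta$, the constant $$M_{\mu,q,\gamma}(\theta)=\max\left\{K_{\mu,q}\exp\left(\frac{2\gamma(\mu+2)\theta}{1-\theta}\right),\ \frac{\mu+1+\theta}{(\mu+2)\theta(\theta-\gamma)}\right\}$$ is (1) nondecreasing in $\mu$; (2) nonincreasing in $q$; (3) strictly increasing in $\gamma$ (in each case with the other parameters fixed). Consequently, the optimized constant $$\widehat M_{\mu,q,\gamma}=\inf_{\gamma<\theta<1}M_{\mu,q,\gamma}(\theta)\qquad(\mu>-1,\ q\ge0,\ 0<\gamma<1)$$ is nondecreasing in $\mu$, nonincreasing in $q$, and nondecreasing in $\gamma$.
   Context: $K_{\mu,q}=\max\left\{1,\frac{2(\mu+1)}{q+1}\right\}$. *)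

theory Defs
  imports Complex_Main
begin

definition K_const :: "real \<Rightarrow> real \<Rightarrow> real" where
  "K_const \<mu> q = max 1 (2 * (\<mu> + 1) / (q + 1))"

definition M_const :: "real \<Rightarrow> real \<Rightarrow> real \<Rightarrow> real \<Rightarrow> real" where
  "M_const \<mu> q \<gamma> \<theta> =
     max (K_const \<mu> q * exp (2 * \<gamma> * (\<mu> + 2) * \<theta> / (1 - \<theta>)))
         ((\<mu> + 1 + \<theta>) / ((\<mu> + 2) * \<theta> * (\<theta> - \<gamma>)))"

(* For 0 < \<gamma> < 1 the set of values is nonempty and, since K_const \<mu> q \<ge> 1, bounded
   below, so the real-valued Inf is the genuine infimum. *)
definition M_opt :: "real \<Rightarrow> real \<Rightarrow> real \<Rightarrow> real" where
  "M_opt \<mu> q \<gamma> = (INF \<theta>\<in>{\<gamma><..<1}. M_const \<mu> q \<gamma> \<theta>)"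

end

theory Submission
  imports Defs
begin

text \<open>
  Both terms of the maximum are monotone in each parameter separately. In the first,
  \<open>K_const \<mu> q\<close> and the exponent are nonnegative and move in the right direction. In the second,
  \<open>(\<mu> + 1 + \<theta>) / (\<mu> + 2) = 1 - (1 - \<theta>) / (\<mu> + 2)\<close>, which increases with \<open>\<mu>\<close> because \<open>\<theta> < 1\<close>,
  and \<open>1 / (\<theta> - \<gamma>)\<close> increases with \<open>\<gamma>\<close>. All the weak monotonicity claims at fixed \<open>\<theta>\<close> are thus
  instances of one joint inequality (\<open>M_const_mono\<close>). Both terms are strictly increasing in
  \<open>\<gamma>\<close>, hence so is their maximum.

  The infimum over \<open>\<theta>\<close> inherits the joint inequality (\<open>M_opt_mono\<close>): raising \<open>\<gamma>\<close> raises the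
  values and shrinks the interval of admissible \<open>\<theta>\<close>, and neither effect can lower the infimum.
  Strictness in \<open>\<gamma>\<close> does not pass to the infimum by this argument.
\<close>

lemma K_const_ge_1: "1 \<le> K_const \<mu> q"
  by (simp add: K_const_def)

lemma K_const_mono:
  assumes "-1 < \<mu>" "\<mu> \<le> \<mu>'" "0 \<le> q'" "q' \<le> q"
  shows "K_const \<mu> q \<le> K_const \<mu>' q'"
proof -
  have "2 * (\<mu> + 1) / (q + 1) \<le> 2 * (\<mu>' + 1) / (q' + 1)"
    using assms by (intro frac_le) auto
  then show ?thesis
    by (auto simp: K_const_def)
qed

lemma exponent_mono:
  fixes \<mu> \<mu>' \<gamma> \<gamma>' \<theta> :: real
  assumes "-1 < \<mu>" "\<mu> \<le> \<mu>'" "0 < \<gamma>" "\<gamma> \<le> \<gamma>'" "0 < \<theta>" "\<theta> < 1"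
  shows "2 * \<gamma> * (\<mu> + 2) * \<theta> / (1 - \<theta>) \<le> 2 * \<gamma>' * (\<mu>' + 2) * \<theta> / (1 - \<theta>)"
  using assms by (intro divide_right_mono mult_right_mono mult_mono) auto

lemma second_term_mono:
  fixes \<mu> \<mu>' \<gamma> \<gamma>' \<theta> :: real
  assumes "-1 < \<mu>" "\<mu> \<le> \<mu>'" "\<gamma> \<le> \<gamma>'" "\<gamma>' < \<theta>" "0 < \<theta>" "\<theta> < 1"
  shows "(\<mu> + 1 + \<theta>) / ((\<mu> + 2) * \<theta> * (\<theta> - \<gamma>))
           \<le> (\<mu>' + 1 + \<theta>) / ((\<mu>' + 2) * \<theta> * (\<theta> - \<gamma>'))"
proof -
  have ratio: "(m + 1 + \<theta>) / (m + 2) = 1 - (1 - \<theta>) / (m + 2)" if "-1 < m" for m :: real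
    using that by (simp add: field_simps)
  have "(1 - \<theta>) / (\<mu>' + 2) \<le> (1 - \<theta>) / (\<mu> + 2)"
    using assms by (intro frac_le) auto
  then have "(\<mu> + 1 + \<theta>) / (\<mu> + 2) \<le> (\<mu>' + 1 + \<theta>) / (\<mu>' + 2)"
    using assms ratio[of \<mu>] ratio[of \<mu>'] by linarith
  moreover have "\<theta> * (\<theta> - \<gamma>') \<le> \<theta> * (\<theta> - \<gamma>)"
    using assms by (intro mult_left_mono) auto
  ultimately have "(\<mu> + 1 + \<theta>) / (\<mu> + 2) / (\<theta> * (\<theta> - \<gamma>))
      \<le> (\<mu>' + 1 + \<theta>) / (\<mu>' + 2) / (\<theta> * (\<theta> - \<gamma>'))"
    using assms by (rule_tac frac_le) auto
  then show ?thesis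
    by (simp only: divide_divide_eq_left mult.assoc)
qed

text \<open>
  Stated jointly in all three parameters, so that each claim about a single parameter, for
  \<open>M_const\<close> and later for the infimum, is an instance.
\<close>

lemma M_const_mono:
  assumes "-1 < \<mu>" "\<mu> \<le> \<mu>'" "0 \<le> q'" "q' \<le> q" "0 < \<gamma>" "\<gamma> \<le> \<gamma>'" "\<gamma>' < \<theta>" "\<theta> < 1"
  shows "M_const \<mu> q \<gamma> \<theta> \<le> M_const \<mu>' q' \<gamma>' \<theta>"
proof -
  have "0 < \<theta>"
    using assms by simp
  have "0 \<le> K_const \<mu>' q'"
    using K_const_ge_1[of \<mu>' q'] by simp
  then have "K_const \<mu> q * exp (2 * \<gamma> * (\<mu> + 2) * \<theta> / (1 - \<theta>))
      \<le> K_const \<mu>' q' * exp (2 * \<gamma>' * (\<mu>' + 2) * \<theta> / (1 - \<theta>))"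
    using assms \<open>0 < \<theta>\<close> K_const_mono exponent_mono by (intro mult_mono) auto
  moreover have "(\<mu> + 1 + \<theta>) / ((\<mu> + 2) * \<theta> * (\<theta> - \<gamma>))
      \<le> (\<mu>' + 1 + \<theta>) / ((\<mu>' + 2) * \<theta> * (\<theta> - \<gamma>'))"
    using assms \<open>0 < \<theta>\<close> by (intro second_term_mono) auto
  ultimately show ?thesis
    unfolding M_const_def by (rule max.mono)
qed

lemma M_const_strict_mono_gamma:
  assumes "-1 < \<mu>" "\<gamma> < \<gamma>'" "\<gamma>' < \<theta>" "0 < \<theta>" "\<theta> < 1"
  shows "M_const \<mu> q \<gamma> \<theta> < M_const \<mu> q \<gamma>' \<theta>"
proof -
  have "2 * \<gamma> * (\<mu> + 2) * \<theta> / (1 - \<theta>) < 2 * \<gamma>' * (\<mu> + 2) * \<theta> / (1 - \<theta>)"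
    using assms by (intro divide_strict_right_mono mult_strict_right_mono) auto
  then have first: "K_const \<mu> q * exp (2 * \<gamma> * (\<mu> + 2) * \<theta> / (1 - \<theta>))
      < K_const \<mu> q * exp (2 * \<gamma>' * (\<mu> + 2) * \<theta> / (1 - \<theta>))"
    using K_const_ge_1[of \<mu> q] by (intro mult_strict_left_mono) auto
  have second: "(\<mu> + 1 + \<theta>) / ((\<mu> + 2) * \<theta> * (\<theta> - \<gamma>))
      < (\<mu> + 1 + \<theta>) / ((\<mu> + 2) * \<theta> * (\<theta> - \<gamma>'))"
    using assms by (intro divide_strict_left_mono mult_strict_left_mono mult_pos_pos) auto
  from first second show ?thesis
    unfolding M_const_def by (auto simp: less_max_iff_disj)
qed

text \<open>
  The infimum of an unbounded set of reals is an unspecified value; this bound gives the infimum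
  defining \<open>M_opt\<close> its intended meaning.
\<close>

lemma M_const_ge_1:
  assumes "-1 < \<mu>" "0 < \<gamma>" "0 < \<theta>" "\<theta> < 1"
  shows "1 \<le> M_const \<mu> q \<gamma> \<theta>"
proof -
  have "0 \<le> 2 * \<gamma> * (\<mu> + 2) * \<theta> / (1 - \<theta>)"
    using assms by simp
  then have "1 * 1 \<le> K_const \<mu> q * exp (2 * \<gamma> * (\<mu> + 2) * \<theta> / (1 - \<theta>))"
    using K_const_ge_1[of \<mu> q] by (intro mult_mono) auto
  then show ?thesis
    by (simp add: M_const_def)
qed

text \<open>
  Every \<open>\<theta>\<close> admissible for \<open>\<gamma>'\<close> is admissible for \<open>\<gamma>\<close>, and there the value at the unprimed
  parameters is the smaller one; so the same \<open>\<theta>\<close> serves as the competitor in the infimum on the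
  left.
\<close>

lemma M_opt_mono:
  assumes "-1 < \<mu>" "\<mu> \<le> \<mu>'" "0 \<le> q'" "q' \<le> q" "0 < \<gamma>" "\<gamma> \<le> \<gamma>'" "\<gamma>' < 1"
  shows "M_opt \<mu> q \<gamma> \<le> M_opt \<mu>' q' \<gamma>'"
  unfolding M_opt_def
proof (rule cINF_mono)
  show "{\<gamma>'<..<1} \<noteq> {}"
    using assms by simp
  show "bdd_below (M_const \<mu> q \<gamma> ` {\<gamma><..<1})"
    using assms by (intro bdd_belowI2[of _ 1] M_const_ge_1) auto
  show "\<exists>\<theta>\<in>{\<gamma><..<1}. M_const \<mu> q \<gamma> \<theta> \<le> M_const \<mu>' q' \<gamma>' \<theta>'" if "\<theta>' \<in> {\<gamma>'<..<1}" for \<theta>'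
    using that assms by (intro bexI[of _ \<theta>'] M_const_mono) auto
qed

theorem theorem7p1:
  shows "(\<forall>\<theta>. 0 < \<theta> \<and> \<theta> < 1 \<longrightarrow>
            (\<forall>q \<gamma>. 0 \<le> q \<and> 0 < \<gamma> \<and> \<gamma> < \<theta> \<longrightarrow>
               mono_on {-1<..} (\<lambda>\<mu>. M_const \<mu> q \<gamma> \<theta>)) \<and>
            (\<forall>\<mu> \<gamma>. -1 < \<mu> \<and> 0 < \<gamma> \<and> \<gamma> < \<theta> \<longrightarrow>
               antimono_on {0..} (\<lambda>q. M_const \<mu> q \<gamma> \<theta>)) \<and>
            (\<forall>\<mu> q. -1 < \<mu> \<and> 0 \<le> q \<longrightarrow>
               strict_mono_on {0<..<\<theta>} (\<lambda>\<gamma>. M_const \<mu> q \<gamma> \<theta>))) \<and>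
         (\<forall>q \<gamma>. 0 \<le> q \<and> 0 < \<gamma> \<and> \<gamma> < 1 \<longrightarrow>
            mono_on {-1<..} (\<lambda>\<mu>. M_opt \<mu> q \<gamma>)) \<and>
         (\<forall>\<mu> \<gamma>. -1 < \<mu> \<and> 0 < \<gamma> \<and> \<gamma> < 1 \<longrightarrow>
            antimono_on {0..} (\<lambda>q. M_opt \<mu> q \<gamma>)) \<and>
         (\<forall>\<mu> q. -1 < \<mu> \<and> 0 \<le> q \<longrightarrow>
            mono_on {0<..<1} (\<lambda>\<gamma>. M_opt \<mu> q \<gamma>))"
  by (intro conjI allI impI monotone_onI)
     (auto intro: M_const_mono M_opt_mono M_const_strict_mono_gamma)

end
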